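(* Let $\zeta\in\mathbb{C}$, let $\{P_n\}$ be the polar Legendre polynomials with pole $\zeta$, let $\{L_n\}$ be the monic Legendre polynomials, and let $\Delta_\zeta=\sup_{x\in[-1,1]}|\zeta-x|$. Then, as $n\to\infty$: 1. $\displaystyle \frac{n\,P_{n}(z)}{L_n'(z)} \to \frac{z^2-1}{z-\zeta}$ uniformly on compact subsets of the set $\{z \in \mathbb{C} : |z| > \Delta_{\zeta}+1\}$. 2. $\displaystyle \frac{P_{n}(z)}{L_n(z)} \to \frac{\sqrt{z^2-1}}{z-\zeta}$ uniformly on compact subsets of the set $\{z \in \mathbb{C} : |z| > \Delta_{\zeta}+1\}$.
   Context: For $n=0,1,2,\dots$, $L_n$ denotes the monic Legendre polynomial of degree $n$, i.e. the monic polynomial of degree $n$ with $\int_{-1}^1 L_n(x)x^k\,dx=0$ for $k=0,\dots,n-1$. For a fixed $\zeta\in\mathbb{C}$ (the pole), the $n$-th polar Legendre polynomial $P_n=P_{\zeta,n}$ is the monic polynomial of degree $n$ determined by $(n+1)L_n(z)=\left((z-\zeta)P_n(z)\right)'$, equivalently $(z-\zeta)P_n(z)=(n+1)\int_\zeta^z L_n(t)\,dt$. The branch of the square root is chosen so that $|z+\sqrt{z^2-1}|>1$ for $z\in\mathbb{C}\setminus[-1,1]$. *)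

theory Defs
  imports "HOL-Analysis.Analysis" "HOL-Computational_Algebra.Polynomial"
begin

definition monic_legendre :: "nat \<Rightarrow> complex poly" where
  "monic_legendre n =
     (THE p. degree p = n \<and> lead_coeff p = 1 \<and>
        (\<forall>k<n. integral {-1..1::real}
                 (\<lambda>x. poly p (complex_of_real x) * complex_of_real x ^ k) = 0))"

definition polar_legendre :: "complex \<Rightarrow> nat \<Rightarrow> complex poly" where
  "polar_legendre \<zeta> n =
     (THE p. degree p = n \<and> lead_coeff p = 1 \<and>
        smult (of_nat (n + 1)) (monic_legendre n) = pderiv ([:- \<zeta>, 1:] * p))"

definition Delta :: "complex \<Rightarrow> real" where
  "Delta \<zeta> = (SUP x\<in>{-1..1::real}. cmod (\<zeta> - complex_of_real x))"

text \<open>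
  The two square roots \<open>w\<close> and \<open>-w\<close> of \<open>z\<^sup>2 - 1\<close> satisfy \<open>(z + w) * (z - w) = 1\<close>, so off the
  segment \<open>[-1,1]\<close> exactly one of them meets the norm condition. On the segment neither does,
  and the value is unspecified.
\<close>
definition sqrt_z2m1 :: "complex \<Rightarrow> complex" where
  "sqrt_z2m1 z = (THE w. w\<^sup>2 = z\<^sup>2 - 1 \<and> cmod (z + w) > 1)"

end

theory Submission
  imports Defs "HOL-Computational_Algebra.Fundamental_Theorem_Algebra"
begin

text \<open>
  Write \<open>L\<close> for the \<open>n\<close>-th monic Legendre polynomial and \<open>P\<close> for the polar one. The Legendre equation
  \<open>((z\<^sup>2 - 1) L')' = n (n + 1) L\<close> provides an antiderivative of \<open>L\<close>, so that
  \<open>n (z - \<zeta>) P(z) = (z\<^sup>2 - 1) L'(z) - (\<zeta>\<^sup>2 - 1) L'(\<zeta>)\<close> (\<open>polar_legendre_formula\<close>). Dividing by \<open>L'(z)\<close>,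
  the first limit amounts to \<open>L'(\<zeta>) / L'(z) \<longrightarrow> 0\<close>. All roots of \<open>L\<close> lie in \<open>[-1,1]\<close>; hence
  \<open>\<bar>L'(\<zeta>)\<bar> \<le> n \<Delta>^n\<close> with \<open>\<Delta> = Delta \<zeta>\<close>, while \<open>\<bar>L'(z)\<bar>\<close> is at least
  \<open>n (\<bar>z\<bar> - 1)^n / (2 \<bar>z\<bar>)\<close>. On a compact subset of \<open>\<bar>z\<bar> > \<Delta> + 1\<close> the quotient decays
  geometrically (\<open>pderiv_legendre_pole_ratio\<close>).

  For the second limit it remains to see that \<open>u = L' / (n L)\<close> tends to \<open>1 / sqrt_z2m1 z\<close>. Divided by
  \<open>n\<^sup>2 L\<close>, the Legendre equation becomes a Riccati equation for \<open>u\<close> in which all terms except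
  \<open>(z\<^sup>2 - 1) u\<^sup>2\<close> and \<open>1\<close> are of order \<open>1 / n\<close> (\<open>normalized_log_deriv_bounds\<close>). So
  \<open>u\<^sup>2 \<longrightarrow> 1 / (z\<^sup>2 - 1)\<close>, and the sign is decided by half-planes: \<open>Re (z u) \<ge> 1/2\<close> because the roots are
  smaller than \<open>z\<close> in modulus, and \<open>Re (z / sqrt_z2m1 z) > 0\<close> by the choice of the branch
  (\<open>normalized_log_deriv_approx\<close>).

  The facts about \<open>L\<close> come from linear algebra. The operator \<open>p \<mapsto> ((x\<^sup>2 - 1) p')'\<close> is triangular on
  monomials with distinct diagonal entries and symmetric for the integral over \<open>[-1,1]\<close>, so it has a
  monic eigenpolynomial of each degree \<open>n\<close>, and this one is orthogonal to all polynomials of lower degree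
  (\<open>legendre_op_eigenpoly\<close>). Positive definiteness identifies it with \<open>L\<close> and confines the
  roots to the segment (\<open>monic_legendre_roots\<close>).
\<close>

section \<open>The Legendre differential operator\<close>

text \<open>
  The Legendre equation is the eigenvalue equation \<open>((x\<^sup>2 - 1) p')' = n (n + 1) p\<close>.
\<close>
definition legendre_op :: "complex poly \<Rightarrow> complex poly" where
  "legendre_op p = pderiv ([:-1, 0, 1:] * pderiv p)"

lemma legendre_op_add: "legendre_op (p + q) = legendre_op p + legendre_op q"
  by (simp only: legendre_op_def pderiv_add distrib_left)

lemma coeff_legendre_op:
  "coeff (legendre_op p) i =
     of_nat (i * (i + 1)) * coeff p i - of_nat ((i + 1) * (i + 2)) * coeff p (i + 2)"
proof -
  have "coeff ([:-1, 0, 1:] * pderiv p) (Suc i) = of_nat i * coeff p i - of_nat (i + 2) * coeff p (i + 2)"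
    by (cases i) (simp_all add: coeff_pderiv)
  thus ?thesis by (simp only: legendre_op_def coeff_pderiv[of "_ * _"]) (simp add: algebra_simps)
qed

text \<open>
  On coefficient sequences the operator is triangular with the diagonal \<open>m (m + 1)\<close>. These
  numbers are distinct, so after subtraction of the eigenvalue for \<open>n\<close> the operator is
  invertible on the polynomials of degree below \<open>n\<close>. This one fact yields both the eigenpolynomial
  of degree \<open>n\<close> and its orthogonality. The degree is bounded by vanishing coefficients, so that
  the empty range \<open>m = 0\<close> can start the induction.
\<close>
lemma legendre_op_shift_surj:
  assumes "m \<le> n" "\<And>i. i \<ge> m \<Longrightarrow> coeff q i = 0"
  shows "\<exists>r. (\<forall>i\<ge>m. coeff r i = 0) \<and> legendre_op r - smult (of_nat (n * (n + 1))) r = q"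
  using assms
proof (induction m arbitrary: q)
  case 0
  hence "q = 0" by (intro poly_eqI) auto
  thus ?case by (intro exI[of _ 0]) (simp add: legendre_op_def)
next
  case (Suc m)
  define c :: complex where "c = of_nat (m * (m + 1)) - of_nat (n * (n + 1))"
  have "m * (m + 1) < n * (n + 1)" using Suc.prems(1) by (intro mult_strict_mono) auto
  hence "c \<noteq> 0" unfolding c_def by (metis of_nat_eq_iff less_irrefl right_minus_eq)
  \<comment> \<open>Choose \<open>r0\<close> to cancel the top coefficient of \<open>q\<close>.\<close>
  define d where "d = coeff q m / c"
  define r0 where "r0 = monom d m"
  define q' where "q' = q - (legendre_op r0 - smult (of_nat (n * (n + 1))) r0)"
  have "coeff q' i = 0" if "i \<ge> m" for i
  proof (cases "i = m")
    case True
    have "coeff q' m = coeff q m - c * d"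
      by (simp add: q'_def r0_def coeff_legendre_op c_def algebra_simps)
    thus ?thesis using \<open>c \<noteq> 0\<close> True by (simp add: d_def)
  next
    case False
    thus ?thesis using that Suc.prems(2)[of i]
      by (simp add: q'_def r0_def coeff_legendre_op)
  qed
  then obtain r where r: "\<forall>i\<ge>m. coeff r i = 0" "legendre_op r - smult (of_nat (n * (n + 1))) r = q'"
    using Suc.IH[of q'] Suc.prems(1) by auto
  show ?case
  proof (intro exI[of _ "r + r0"] conjI allI impI)
    show "coeff (r + r0) i = 0" if "Suc m \<le> i" for i
      using r(1) that by (simp add: r0_def)
    show "legendre_op (r + r0) - smult (of_nat (n * (n + 1))) (r + r0) = q"
      using r(2) by (simp add: q'_def legendre_op_add smult_add_right algebra_simps)
  qed
qed

section \<open>Integration of polynomials over the segment\<close>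

definition segment_integral :: "complex poly \<Rightarrow> complex" where
  "segment_integral p = integral {-1..1::real} (\<lambda>x. poly p (complex_of_real x))"

lemma poly_of_real_integrable: "(\<lambda>x. poly p (complex_of_real x)) integrable_on {-1..1}"
  by (intro integrable_continuous_real continuous_intros)

lemma segment_integral_diff:
  "segment_integral (p - q) = segment_integral p - segment_integral q"
  unfolding segment_integral_def poly_diff
  by (intro integral_diff poly_of_real_integrable)

lemma segment_integral_smult: "segment_integral (smult c p) = c * segment_integral p"
  unfolding segment_integral_def poly_smult by (rule integral_mult_right)

lemma segment_integral_sum:
  "finite A \<Longrightarrow> segment_integral (\<Sum>a\<in>A. f a) = (\<Sum>a\<in>A. segment_integral (f a))"
  unfolding segment_integral_def poly_sum
  by (rule integral_sum) (auto intro: poly_of_real_integrable)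

lemma segment_integral_pderiv: "segment_integral (pderiv p) = poly p 1 - poly p (-1)"
proof -
  have "((\<lambda>x. poly (pderiv p) (complex_of_real x)) has_integral
          poly p (complex_of_real 1) - poly p (complex_of_real (-1))) {-1..1}"
  proof (rule fundamental_theorem_of_calculus)
    fix x :: real
    have "((poly p \<circ> complex_of_real) has_vector_derivative 1 * poly (pderiv p) (of_real x))
            (at x within {-1..1})"
      by (rule field_vector_diff_chain_within)
         (auto intro!: has_vector_derivative_of_real DERIV_subset[OF poly_DERIV] derivative_eq_intros)
    thus "((\<lambda>x. poly p (complex_of_real x)) has_vector_derivative poly (pderiv p) (of_real x))
            (at x within {-1..1})"
      by (simp add: o_def)
  qed simp
  thus ?thesis by (simp add: segment_integral_def integral_unique)
qed

text \<open>
  The difference of the integrands is the derivative of \<open>(x\<^sup>2 - 1) (p' q - p q')\<close>, which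
  vanishes at both endpoints.
\<close>
lemma legendre_op_symmetric:
  "segment_integral (legendre_op p * q) = segment_integral (p * legendre_op q)"
proof -
  define w :: "complex poly" where "w = [:-1, 0, 1:]"
  have "legendre_op p * q - p * legendre_op q = pderiv (w * (pderiv p * q - p * pderiv q))"
    unfolding legendre_op_def w_def[symmetric]
    by (simp add: pderiv_mult pderiv_diff algebra_simps)
  hence "segment_integral (legendre_op p * q) - segment_integral (p * legendre_op q) = 0"
    by (simp add: segment_integral_diff[symmetric] segment_integral_pderiv w_def)
  thus ?thesis by simp
qed

section \<open>Monic Legendre polynomials\<close>

text \<open>
  To obtain \<open>p\<close>, correct \<open>x^n\<close> by a polynomial of lower degree. If \<open>q\<close> has degree below \<open>n\<close>,
  write \<open>q = (T - \<lambda>) s\<close> for the Legendre operator \<open>T\<close> and the eigenvalue \<open>\<lambda>\<close>; by symmetry of \<open>T\<close>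
  the integral of \<open>p q\<close> is that of \<open>((T - \<lambda>) p) s = 0\<close>.
\<close>
lemma legendre_op_eigenpoly:
  obtains p where "degree p = n" "lead_coeff p = 1"
    "legendre_op p = smult (of_nat (n * (n + 1))) p"
    "\<And>q. (\<And>i. i \<ge> n \<Longrightarrow> coeff q i = 0) \<Longrightarrow> segment_integral (p * q) = 0"
proof -
  define l :: complex where "l = of_nat (n * (n + 1))"
  define x where "x = (monom 1 n :: complex poly)"
  have "coeff (smult l x - legendre_op x) i = 0" if "i \<ge> n" for i
    using that by (cases "i = n") (simp_all add: x_def l_def coeff_legendre_op)
  then obtain r where r: "\<forall>i\<ge>n. coeff r i = 0" "legendre_op r - smult l r = smult l x - legendre_op x"
    using legendre_op_shift_surj[of n n "smult l x - legendre_op x"] unfolding l_def by auto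
  define p where "p = x + r"
  have eig: "legendre_op p = smult l p"
    using r(2) by (simp add: p_def legendre_op_add smult_add_right algebra_simps)
  have cn: "coeff p n = 1" and ci: "\<And>i. i > n \<Longrightarrow> coeff p i = 0"
    using r(1) by (auto simp: p_def x_def)
  have deg: "degree p = n"
    by (rule antisym) (use cn ci in \<open>auto intro!: degree_le le_degree\<close>)
  show ?thesis
  proof
    show "degree p = n" "lead_coeff p = 1" using deg cn by auto
    show "legendre_op p = smult (of_nat (n * (n + 1))) p" using eig by (simp add: l_def)
    fix q assume "\<And>i. i \<ge> n \<Longrightarrow> coeff q i = (0::complex)"
    then obtain s where s: "legendre_op s - smult l s = q"
      using legendre_op_shift_surj[of n n q] unfolding l_def by auto
    have "segment_integral (p * q) =
            segment_integral (p * legendre_op s) - l * segment_integral (p * s)"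
      by (simp add: s[symmetric] right_diff_distrib segment_integral_diff segment_integral_smult)
    also have "\<dots> = 0"
      by (simp add: legendre_op_symmetric[symmetric] eig segment_integral_smult)
    finally show "segment_integral (p * q) = 0" .
  qed
qed

lemma orthogonal_to_lower_degree:
  assumes "\<And>k. k < n \<Longrightarrow> segment_integral (p * monom 1 k) = 0"
    and "\<And>i. i \<ge> n \<Longrightarrow> coeff q i = 0"
  shows "segment_integral (p * q) = 0"
proof -
  have "q = (\<Sum>i\<le>degree q. smult (coeff q i) (monom 1 i))"
    by (simp add: smult_monom poly_as_sum_of_monoms)
  hence "segment_integral (p * q) = segment_integral (p * (\<Sum>i\<le>degree q. smult (coeff q i) (monom 1 i)))"
    by simp
  also have "\<dots> = (\<Sum>i\<le>degree q. coeff q i * segment_integral (p * monom 1 i))"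
    by (simp add: sum_distrib_left segment_integral_sum segment_integral_smult)
  also have "\<dots> = 0"
    using assms by (intro sum.neutral) (metis linorder_not_less mult_eq_0_iff)
  finally show ?thesis .
qed

lemma poly_mult_cnj_of_real:
  "poly (p * map_poly cnj p) (complex_of_real x) = of_real ((cmod (poly p (of_real x)))\<^sup>2)"
  by (simp add: complex_norm_square[symmetric])

text \<open>
  Positive definiteness of the integral inner product is behind both the uniqueness of the monic
  Legendre polynomial and the location of its roots.
\<close>
lemma norm_square_integral_pos:
  assumes "p \<noteq> 0"
  shows "integral {-1..1::real} (\<lambda>x. (cmod (poly p (of_real x)))\<^sup>2) > 0"
proof -
  let ?f = "\<lambda>x::real. (cmod (poly p (of_real x)))\<^sup>2"
  have cont: "continuous_on {-1..1} ?f" by (intro continuous_intros)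
  have "integral {-1..1} ?f \<ge> 0"
    by (rule Henstock_Kurzweil_Integration.integral_nonneg)
       (auto intro!: integrable_continuous_real cont)
  moreover have "integral {-1..1} ?f \<noteq> 0"
  proof
    assume "integral {-1..1} ?f = 0"
    hence "\<forall>x\<in>{-1..1}. ?f x = 0" by (subst (asm) integral_eq_0_iff[OF cont]) auto
    hence "complex_of_real ` {-1..1} \<subseteq> {z. poly p z = 0}" by auto
    moreover have "infinite (complex_of_real ` {-1..1})"
      by (subst finite_image_iff) (auto simp: inj_on_def infinite_Icc)
    ultimately show False using poly_roots_finite[OF assms] finite_subset by blast
  qed
  ultimately show ?thesis by linarith
qed

lemma segment_integral_mult_cnj:
  "segment_integral (p * map_poly cnj p) = of_real (integral {-1..1} (\<lambda>x. (cmod (poly p (of_real x)))\<^sup>2))"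
  unfolding segment_integral_def poly_mult_cnj_of_real
  by (intro integral_unique has_integral_of_real integrable_integral integrable_continuous_real
        continuous_intros)

lemma coeff_map_poly_cnj: "coeff (map_poly cnj p) i = cnj (coeff p i)"
  by (simp add: coeff_map_poly)

text \<open>
  The difference \<open>d\<close> of two monic polynomials of degree \<open>n\<close> with the defining orthogonality has
  degree below \<open>n\<close>, hence is orthogonal to itself and vanishes. So the definite description
  picks out the eigenpolynomial of the Legendre operator.
\<close>
lemma monic_legendre_props:
  shows "degree (monic_legendre n) = n" (is ?A)
    and "lead_coeff (monic_legendre n) = 1" (is ?B)
    and "legendre_op (monic_legendre n) = smult (of_nat (n * (n + 1))) (monic_legendre n)" (is ?C)
    and "\<And>q. (\<And>i. i \<ge> n \<Longrightarrow> coeff q i = 0) \<Longrightarrow> segment_integral (monic_legendre n * q) = 0"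
proof -
  obtain p where p: "degree p = n" "lead_coeff p = 1"
    "legendre_op p = smult (of_nat (n * (n + 1))) p"
    "\<And>q. (\<And>i. i \<ge> n \<Longrightarrow> coeff q i = 0) \<Longrightarrow> segment_integral (p * q) = 0"
    using legendre_op_eigenpoly by blast
  have moment: "integral {-1..1::real} (\<lambda>x. poly q (complex_of_real x) * complex_of_real x ^ k) =
      segment_integral (q * monom 1 k)" for q k
    by (simp add: segment_integral_def poly_monom)
  have "monic_legendre n = p"
    unfolding monic_legendre_def moment
  proof (rule the_equality)
    show "degree p = n \<and> lead_coeff p = 1 \<and> (\<forall>k<n. segment_integral (p * monom 1 k) = 0)"
      using p by auto
    fix p' assume p': "degree p' = n \<and> lead_coeff p' = 1 \<and> (\<forall>k<n. segment_integral (p' * monom 1 k) = 0)"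
    define d where "d = p' - p"
    have d: "coeff d i = 0" if "i \<ge> n" for i
      using that p p' by (cases "i = n") (auto simp: d_def coeff_eq_0)
    have "segment_integral (d * monom 1 k) = 0" if "k < n" for k
      using that p(4)[of "monom 1 k"] p' by (simp add: d_def left_diff_distrib segment_integral_diff)
    hence "segment_integral (d * map_poly cnj d) = 0"
      by (rule orthogonal_to_lower_degree) (auto simp: coeff_map_poly_cnj d)
    hence "d = 0"
      using norm_square_integral_pos[of d] by (auto simp: segment_integral_mult_cnj)
    thus "p' = p" by (simp add: d_def)
  qed
  thus ?A ?B ?C "\<And>q. (\<And>i. i \<ge> n \<Longrightarrow> coeff q i = 0) \<Longrightarrow> segment_integral (monic_legendre n * q) = 0"
    using p by simp_all
qed

text \<open>
  If \<open>L = (x - a) q\<close>, then \<open>L\<close> is orthogonal to the conjugate of \<open>q\<close>, so the integral of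
  \<open>(x - a) \<bar>q\<bar>\<^sup>2\<close> vanishes: the root \<open>a\<close> is the mean of \<open>x\<close> with respect to the positive
  weight \<open>\<bar>q\<bar>\<^sup>2\<close> on \<open>[-1,1]\<close>.
\<close>
lemma monic_legendre_roots:
  assumes "poly (monic_legendre n) a = 0"
  shows "a \<in> complex_of_real ` {-1..1}"
proof -
  obtain q where q: "monic_legendre n = [:-a, 1:] * q"
    using assms unfolding poly_eq_0_iff_dvd by (elim dvdE)
  have q0: "q \<noteq> 0" using q monic_legendre_props(2)[of n] by auto
  have "degree (monic_legendre n) = Suc (degree q)" 
    unfolding q using q0 by (subst degree_mult_eq) auto
  hence deg: "Suc (degree q) = n" by (simp add: monic_legendre_props)
  let ?f = "\<lambda>x::real. (cmod (poly q (of_real x)))\<^sup>2"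
  define A where "A = integral {-1..1} (\<lambda>x. x * ?f x)"
  define B where "B = integral {-1..1} ?f"
  have B: "B > 0" unfolding B_def by (rule norm_square_integral_pos[OF q0])
  have int: "?f integrable_on {-1..1}" "(\<lambda>x. x * ?f x) integrable_on {-1..1}"
    by (intro integrable_continuous_real continuous_intros)+
  have mean_le: "x * ?f x \<le> ?f x" and mean_ge: "- ?f x \<le> x * ?f x" if "x \<in> {-1..1}" for x
    using that mult_right_mono[of x 1 "?f x"] mult_right_mono[of "-1" x "?f x"] by auto
  have "segment_integral (monic_legendre n * map_poly cnj q) = 0"
    using deg by (intro monic_legendre_props) (auto simp: coeff_map_poly_cnj coeff_eq_0)
  also have "monic_legendre n * map_poly cnj q =
      [:0, 1:] * (q * map_poly cnj q) - smult a (q * map_poly cnj q)"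
    unfolding q by (simp add: algebra_simps)
  also have "segment_integral \<dots> =
      segment_integral ([:0, 1:] * (q * map_poly cnj q)) - a * of_real B"
    unfolding segment_integral_diff segment_integral_smult segment_integral_mult_cnj B_def ..
  also have "segment_integral ([:0, 1:] * (q * map_poly cnj q)) = of_real A"
  proof -
    have "poly ([:0, 1:] * (q * map_poly cnj q)) (of_real x) = of_real (x * ?f x)" for x :: real
      by (simp only: poly_mult[of "[:0,1:]"] poly_mult_cnj_of_real) simp
    thus ?thesis unfolding segment_integral_def A_def
      by (simp only:) (intro integral_unique has_integral_of_real integrable_integral int(2))
  qed
  finally have "a = of_real (A / B)" using B by (simp add: field_simps)
  moreover have "A \<le> B"
    unfolding A_def B_def using int mean_le by (intro integral_le) auto
  moreover have "- B \<le> A"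
    unfolding A_def B_def integral_neg[symmetric] using int mean_ge
    by (intro integral_le integrable_neg) auto
  ultimately have "a = of_real (A / B)" "A / B \<in> {-1..1}" using B by (auto simp: field_simps)
  thus "a \<in> complex_of_real ` {-1..1}" by blast
qed


section \<open>Products of linear factors\<close>

text \<open>
  Expressing both derivatives through power sums of \<open>1 / (z - r i)\<close> turns the second-order Legendre
  equation into an algebraic identity at each point \<open>z\<close>, without differentiating a quotient.
\<close>
lemma prod_linear_pderivs:
  fixes r :: "nat \<Rightarrow> complex"
  assumes "\<And>i. i < n \<Longrightarrow> z \<noteq> r i"
  defines "p \<equiv> \<Prod>i<n. [:- r i, 1:]"
  defines "S \<equiv> \<Sum>i<n. 1 / (z - r i)" and "S2 \<equiv> \<Sum>i<n. 1 / (z - r i)\<^sup>2"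
  shows "poly (pderiv p) z = poly p z * S"
    and "poly (pderiv (pderiv p)) z = poly p z * (S\<^sup>2 - S2)"
proof -
  have "poly (pderiv p) z = poly p z * S \<and> poly (pderiv (pderiv p)) z = poly p z * (S\<^sup>2 - S2)"
    using assms(1) unfolding p_def S_def S2_def
  proof (induction n)
    case 0
    thus ?case by simp
  next
    case (Suc n)
    define q where "q = (\<Prod>i<n. [:- r i, 1:])"
    define s where "s = (\<Sum>i<n. 1 / (z - r i))"
    define s2 where "s2 = (\<Sum>i<n. 1 / (z - r i)\<^sup>2)"
    define a where "a = z - r n"
    have IH: "poly (pderiv q) z = poly q z * s" "poly (pderiv (pderiv q)) z = poly q z * (s\<^sup>2 - s2)"
      using Suc unfolding q_def s_def s2_def by auto
    have a: "a \<noteq> 0" using Suc.prems by (auto simp: a_def)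
    have lin: "pderiv [:- r n, 1:] = 1" "poly [:- r n, 1:] z = a" by (simp_all add: pderiv_pCons a_def)
    have "poly (pderiv (q * [:- r n, 1:])) z = a * poly q z * (s + 1 / a)"
      using a by (simp only: pderiv_mult lin poly_add poly_mult poly_1 IH) (simp add: field_simps)
    moreover have "poly (pderiv (pderiv (q * [:- r n, 1:]))) z =
        a * poly q z * ((s + 1 / a)\<^sup>2 - (s2 + 1 / a\<^sup>2))"
      using a
      by (simp only: pderiv_mult lin pderiv_add pderiv_1 poly_add poly_mult poly_1 poly_0 IH)
         (simp add: field_simps power2_eq_square)
    ultimately show ?case
      unfolding prod.lessThan_Suc sum.lessThan_Suc q_def[symmetric] s_def[symmetric]
        s2_def[symmetric] a_def[symmetric] poly_mult lin
      by (simp add: mult_ac)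
  qed
  thus "poly (pderiv p) z = poly p z * S" "poly (pderiv (pderiv p)) z = poly p z * (S\<^sup>2 - S2)"
    by blast+
qed

lemma norm_poly_prod_linear_le:
  fixes r :: "nat \<Rightarrow> complex"
  assumes "\<And>i. i < n \<Longrightarrow> cmod (a - r i) \<le> D"
  shows "cmod (poly (\<Prod>i<n. [:- r i, 1:]) a) \<le> D ^ n"
proof -
  have "cmod (poly (\<Prod>i<n. [:- r i, 1:]) a) = (\<Prod>i<n. cmod (a - r i))"
    by (simp add: poly_prod prod_norm)
  also have "\<dots> \<le> (\<Prod>i<n. D)" using assms by (intro prod_mono) auto
  finally show ?thesis by simp
qed

lemma norm_poly_pderiv_prod_linear_le:
  fixes r :: "nat \<Rightarrow> complex"
  assumes "\<And>i. i < n \<Longrightarrow> cmod (a - r i) \<le> D" "D \<ge> 1"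
  shows "cmod (poly (pderiv (\<Prod>i<n. [:- r i, 1:])) a) \<le> real n * D ^ n"
  using assms(1)
proof (induction n)
  case (Suc n)
  define q where "q = (\<Prod>i<n. [:- r i, 1:])"
  have "poly (pderiv (q * [:- r n, 1:])) a = poly q a + (a - r n) * poly (pderiv q) a"
    by (simp only: pderiv_mult) (simp add: pderiv_pCons algebra_simps)
  also have "cmod \<dots> \<le> D ^ n + D * (real n * D ^ n)"
    using Suc norm_poly_prod_linear_le[of n a r D] assms(2) unfolding q_def
    by (intro order.trans[OF norm_triangle_ineq] add_mono) (auto simp: norm_mult intro!: mult_mono)
  also have "\<dots> \<le> D * D ^ n + D * (real n * D ^ n)"
    using assms(2) by (intro add_right_mono) simp
  also have "\<dots> = real (Suc n) * D ^ Suc n" by (simp add: algebra_simps)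
  finally show ?case by (simp add: q_def mult_ac)
qed simp

lemma norm_poly_prod_linear_ge:
  fixes r :: "nat \<Rightarrow> complex"
  assumes "\<And>i. i < n \<Longrightarrow> cmod (r i) \<le> 1" "cmod z \<ge> 1"
  shows "(cmod z - 1) ^ n \<le> cmod (poly (\<Prod>i<n. [:- r i, 1:]) z)"
proof -
  have "(cmod z - 1) ^ n = (\<Prod>i<n. cmod z - 1)" by simp
  also have "\<dots> \<le> (\<Prod>i<n. cmod (z - r i))"
    using assms norm_triangle_ineq2[of z] by (intro prod_mono) (auto, smt (verit))
  also have "\<dots> = cmod (poly (\<Prod>i<n. [:- r i, 1:]) z)" by (simp add: poly_prod prod_norm)
  finally show ?thesis .
qed

text \<open>
  With \<open>w = z / (z - x)\<close> the difference \<open>w - 1\<close> is \<open>x / (z - x)\<close>, so \<open>w\<close> is at least as far from \<open>0\<close> as from \<open>1\<close>.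
\<close>
lemma Re_divide_diff_ge_half:
  assumes "cmod x < cmod z"
  shows "Re (z / (z - x)) \<ge> 1 / 2"
proof -
  define w where "w = z / (z - x)"
  have ne: "z \<noteq> x" using assms by auto
  hence "w - 1 = x / (z - x)" by (simp add: w_def field_simps)
  hence "cmod (w - 1) \<le> cmod w" using assms by (simp add: w_def norm_divide divide_right_mono)
  hence "(cmod (w - 1))\<^sup>2 \<le> (cmod w)\<^sup>2" by (intro power_mono) auto
  thus ?thesis unfolding w_def[symmetric] cmod_power2 by (simp add: power2_eq_square algebra_simps)
qed

section \<open>The square root and the distance to the segment\<close>

text \<open>
  If \<open>s\<^sup>2 = z\<^sup>2 - 1\<close> then \<open>(z + s) (z - s) = 1\<close>. Thus \<open>\<bar>z + s\<bar> > 1\<close> means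
  \<open>\<bar>z - s\<bar> < \<bar>z + s\<bar>\<close>, that is, \<open>z / s\<close> lies in the right half-plane. In this form the choice of
  the branch is compared with the logarithmic derivative of the Legendre polynomials.
\<close>
lemma sqrt_z2m1_props:
  assumes "cmod z > 1"
  shows "(sqrt_z2m1 z)\<^sup>2 = z\<^sup>2 - 1" and "Re (z / sqrt_z2m1 z) > 0"
proof -
  have prod1: "cmod (z + w) * cmod (z - w) = 1" if "w\<^sup>2 = z\<^sup>2 - 1" for w
  proof -
    have "(z + w) * (z - w) = 1" using that by (simp add: algebra_simps power2_eq_square)
    thus ?thesis by (metis norm_mult norm_one)
  qed
  have lt1: "cmod (z - w) < 1" if "w\<^sup>2 = z\<^sup>2 - 1" "cmod (z + w) > 1" for w
    using prod1[OF that(1)] that(2)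
    by (smt (verit, best) mult_cancel_right1 mult_less_cancel_right norm_ge_zero)
  define w where "w = csqrt (z\<^sup>2 - 1)"
  have w: "w\<^sup>2 = z\<^sup>2 - 1" by (simp add: w_def)
  \<comment> \<open>Both norms being \<open>1\<close> would force \<open>\<bar>z\<bar> \<le> 1\<close>.\<close>
  have "cmod (2 * z) \<le> cmod (z + w) + cmod (z - w)"
    using norm_triangle_ineq[of "z + w" "z - w"] by simp
  hence "cmod (z + w) > 1 \<or> cmod (z - w) > 1"
    using assms by (simp add: norm_mult) linarith
  hence ex: "\<exists>s. s\<^sup>2 = z\<^sup>2 - 1 \<and> cmod (z + s) > 1"
    using w by (metis diff_conv_add_uminus power2_minus)
  have "\<exists>!s. s\<^sup>2 = z\<^sup>2 - 1 \<and> cmod (z + s) > 1"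
  proof (rule ex_ex1I[OF ex])
    fix s t assume st: "s\<^sup>2 = z\<^sup>2 - 1 \<and> cmod (z + s) > 1" "t\<^sup>2 = z\<^sup>2 - 1 \<and> cmod (z + t) > 1"
    hence "s = t \<or> s = - t" by (metis power2_eq_iff)
    thus "s = t" using lt1[of t] st by auto
  qed
  from theI'[OF this] have s: "(sqrt_z2m1 z)\<^sup>2 = z\<^sup>2 - 1" "cmod (z + sqrt_z2m1 z) > 1"
    unfolding sqrt_z2m1_def by auto
  show "(sqrt_z2m1 z)\<^sup>2 = z\<^sup>2 - 1" by fact
  define s where "s = sqrt_z2m1 z"
  have s0: "s \<noteq> 0" using lt1[OF s] s(2) by (auto simp: s_def)
  have "cmod (z - s) < cmod (z + s)" using lt1[OF s] s(2) by (simp add: s_def)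
  moreover have "z / s - 1 = (z - s) / s" "z / s + 1 = (z + s) / s"
    using s0 by (auto simp: field_simps)
  ultimately have "cmod (z / s - 1) < cmod (z / s + 1)"
    using s0 by (simp add: norm_divide divide_strict_right_mono)
  hence "(cmod (z / s - 1))\<^sup>2 < (cmod (z / s + 1))\<^sup>2" by (intro power_strict_mono) auto
  thus "Re (z / sqrt_z2m1 z) > 0"
    unfolding s_def[symmetric] cmod_power2 by (simp add: power2_eq_square algebra_simps)
qed

lemma norm_diff_le_Delta:
  assumes "x \<in> {-1..1}"
  shows "cmod (\<zeta> - of_real x) \<le> Delta \<zeta>"
  unfolding Delta_def
proof (rule cSUP_upper[OF assms])
  have "compact ((\<lambda>x. cmod (\<zeta> - of_real x)) ` {-1..1})"
    by (intro compact_continuous_image continuous_intros) auto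
  thus "bdd_above ((\<lambda>x. cmod (\<zeta> - of_real x)) ` {-1..1})"
    by (intro bounded_imp_bdd_above compact_imp_bounded)
qed

lemma Delta_ge: "Delta \<zeta> \<ge> 1" "Delta \<zeta> \<ge> cmod \<zeta>"
proof -
  \<comment> \<open>The endpoints of the segment have distance \<open>2\<close>.\<close>
  have "cmod ((\<zeta> - of_real (-1)) - (\<zeta> - of_real 1)) \<le> Delta \<zeta> + Delta \<zeta>"
    by (intro order.trans[OF norm_triangle_ineq4] add_mono norm_diff_le_Delta) auto
  thus "Delta \<zeta> \<ge> 1" by simp
  show "Delta \<zeta> \<ge> cmod \<zeta>" using norm_diff_le_Delta[of 0 \<zeta>] by simp
qed



section \<open>Root factorization and the pointwise Legendre equation\<close>

lemma monic_legendre_factorization: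
  obtains r where "monic_legendre n = (\<Prod>i<n. [:- complex_of_real (r i), 1:])"
    and "\<And>i. i < n \<Longrightarrow> r i \<in> {-1..1}"
proof -
  obtain c where "smult (lead_coeff (monic_legendre n))
      (\<Prod>i<degree (monic_legendre n). [:- c i, 1:]) = monic_legendre n"
    by (rule complex_poly_decompose')
  hence c: "monic_legendre n = (\<Prod>i<n. [:- c i, 1:])"
    unfolding monic_legendre_props(2) unfolding monic_legendre_props(1)
    by simp
  have real: "\<exists>x. c i = of_real x \<and> x \<in> {-1..1}" if "i < n" for i
  proof -
    have "poly (monic_legendre n) (c i) = 0" unfolding c using that by (auto simp: poly_prod)
    thus ?thesis using monic_legendre_roots by blast
  qed
  have Re_c: "c i = of_real (Re (c i))" "Re (c i) \<in> {-1..1}" if "i < n" for i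
    using real[OF that] by auto
  have "monic_legendre n = (\<Prod>i<n. [:- complex_of_real (Re (c i)), 1:])"
    unfolding c using Re_c(1) by (intro prod.cong) auto
  thus thesis using Re_c(2) by (rule that[of "\<lambda>i. Re (c i)"])
qed

lemma monic_legendre_ode:
  "(z\<^sup>2 - 1) * poly (pderiv (pderiv (monic_legendre n))) z + 2 * z * poly (pderiv (monic_legendre n)) z
     = of_nat (n * (n + 1)) * poly (monic_legendre n) z"
proof -
  have "poly (legendre_op (monic_legendre n)) z = of_nat (n * (n + 1)) * poly (monic_legendre n) z"
    by (simp only: monic_legendre_props(3) poly_smult)
  thus ?thesis
    unfolding legendre_op_def pderiv_mult poly_add poly_mult
    by (simp add: pderiv_pCons power2_eq_square algebra_simps)
qed

section \<open>The normalized logarithmic derivative\<close>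

definition normalized_log_deriv :: "nat \<Rightarrow> complex \<Rightarrow> complex" where
  "normalized_log_deriv n z = poly (pderiv (monic_legendre n)) z / (of_nat n * poly (monic_legendre n) z)"

text \<open>
  With the roots \<open>r i\<close>, the function is \<open>u = S / n\<close> for \<open>S = (\<Sum>i<n. 1 / (z - r i))\<close>. Since
  \<open>L'' / L = S\<^sup>2 - S2\<close> with \<open>S2\<close> the sum of the squared reciprocals, the Legendre equation reads
  \<open>(z\<^sup>2 - 1) (S\<^sup>2 - S2) + 2 z S = n (n + 1)\<close>. The terms \<open>S2\<close> and \<open>2 z S\<close> are of order \<open>n\<close> only, so
  division by \<open>n\<^sup>2\<close> shows that \<open>u\<^sup>2\<close> approaches \<open>1 / (z\<^sup>2 - 1)\<close>.
\<close>
lemma normalized_log_deriv_bounds: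
  assumes "n > 0" "cmod z \<ge> 2"
  shows "poly (monic_legendre n) z \<noteq> 0"
    and "cmod (normalized_log_deriv n z) \<le> 1"
    and "Re (z * normalized_log_deriv n z) \<ge> 1 / 2"
    and "cmod ((normalized_log_deriv n z)\<^sup>2 - 1 / (z\<^sup>2 - 1)) \<le> (2 + cmod z) / n"
proof -
  obtain x where x: "monic_legendre n = (\<Prod>i<n. [:- complex_of_real (x i), 1:])"
    "\<And>i. i < n \<Longrightarrow> x i \<in> {-1..1}"
    using monic_legendre_factorization[of n] by blast
  define r where "r = (\<lambda>i. complex_of_real (x i))"
  define L where "L = monic_legendre n"
  have L: "L = (\<Prod>i<n. [:- r i, 1:])" using x(1) by (simp add: L_def r_def)
  have r: "cmod (r i) \<le> 1" if "i < n" for i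
    using x(2)[OF that] by (auto simp: r_def)
  have dist: "cmod (z - r i) \<ge> 1" if "i < n" for i
    using r[OF that] assms(2) norm_triangle_ineq2[of z "r i"] by linarith
  have ne: "z \<noteq> r i" if "i < n" for i using dist[OF that] by auto
  have L0: "poly L z \<noteq> 0" unfolding L using ne by (simp add: poly_prod)
  thus "poly (monic_legendre n) z \<noteq> 0" by (simp add: L_def)
  define S where "S = (\<Sum>i<n. 1 / (z - r i))"
  define S2 where "S2 = (\<Sum>i<n. 1 / (z - r i)\<^sup>2)"
  define u where "u = normalized_log_deriv n z"
  have derivs: "poly (pderiv L) z = poly L z * S"
    "poly (pderiv (pderiv L)) z = poly L z * (S\<^sup>2 - S2)"
    using prod_linear_pderivs[of n z r] ne unfolding L S_def S2_def by auto
  have Su: "S = of_nat n * u"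
    using L0 assms(1) derivs(1) by (simp add: u_def normalized_log_deriv_def L_def)
  have "cmod S \<le> (\<Sum>i<n. 1)"
    unfolding S_def by (rule sum_norm_le) (use dist in \<open>auto simp: norm_divide divide_simps\<close>)
  thus u1: "cmod (normalized_log_deriv n z) \<le> 1"
    unfolding Su u_def[symmetric] using assms(1) by (simp add: norm_mult)
  have "Re (z * S) = (\<Sum>i<n. Re (z / (z - r i)))"
    by (simp add: S_def sum_distrib_left)
  also have "\<dots> \<ge> (\<Sum>i<n. 1 / 2)"
    using r assms(2) by (intro sum_mono Re_divide_diff_ge_half) (use r assms(2) in force)
  finally have "real n * (1 / 2) \<le> real n * Re (z * u)" by (simp add: Su algebra_simps)
  thus "Re (z * normalized_log_deriv n z) \<ge> 1 / 2"
    unfolding u_def[symmetric] using assms(1) by (subst (asm) mult_le_cancel_left_pos) auto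
  have S2: "cmod S2 \<le> n"
  proof -
    have "cmod S2 \<le> (\<Sum>i<n. 1)" unfolding S2_def
      by (rule sum_norm_le) (use dist in \<open>auto simp: norm_divide norm_power divide_simps\<close>)
    thus ?thesis by simp
  qed
  define y where "y = z\<^sup>2 - 1"
  have "cmod (z\<^sup>2) \<ge> 2\<^sup>2" unfolding norm_power using assms(2) by (intro power_mono) auto
  hence y: "cmod y \<ge> 3" using norm_triangle_ineq2[of "z\<^sup>2" 1] by (simp add: y_def)
  hence y0: "y \<noteq> 0" by auto
  have "poly L z * (y * (S\<^sup>2 - S2) + 2 * z * S) = poly L z * of_nat (n * (n + 1))"
    using monic_legendre_ode[of z n] by (simp add: L_def[symmetric] derivs y_def algebra_simps)
  hence riccati: "y * (S\<^sup>2 - S2) + 2 * z * S = of_nat (n * (n + 1))" using L0 by simp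
  define N :: complex where "N = of_nat n"
  have N: "N \<noteq> 0" using assms(1) by (simp add: N_def)
  have "y * (N\<^sup>2 * u\<^sup>2 - S2) + 2 * z * (N * u) = N * (N + 1)"
    using riccati unfolding Su by (simp add: N_def power_mult_distrib distrib_left)
  hence "(u\<^sup>2 * y - 1) * N\<^sup>2 = (1 + y * S2 / N - 2 * z * u) * N"
    using N by (simp add: algebra_simps power2_eq_square)
  hence "u\<^sup>2 * y - 1 = (1 + y * S2 / N - 2 * z * u) / N"
    using N by (simp add: power2_eq_square nonzero_eq_divide_eq)
  moreover have "u\<^sup>2 - 1 / y = (u\<^sup>2 * y - 1) / y"
    using y0 by (simp add: diff_divide_distrib)
  ultimately have "u\<^sup>2 - 1 / y = (1 / y + S2 / N - 2 * z * u / y) / N"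
    using y0 by (simp add: add_divide_distrib diff_divide_distrib divide_divide_eq_left mult_ac)
  also have "cmod \<dots> \<le> (1 + 1 + cmod z) / n"
  proof -
    have 1: "cmod (1 / y) \<le> 1" using y by (simp add: norm_divide divide_simps)
    have 2: "cmod (S2 / N) \<le> 1" using S2 assms(1) by (simp add: N_def norm_divide divide_simps)
    have "cmod (2 * z * u / y) = 2 * cmod z * cmod u / cmod y" by (simp add: norm_mult norm_divide)
    also have "\<dots> \<le> 2 * cmod z * 1 / 3"
      using y u1 unfolding u_def[symmetric] by (intro frac_le mult_left_mono) auto
    finally have 3: "cmod (2 * z * u / y) \<le> cmod z" using norm_ge_zero[of z] by linarith
    have "cmod (1 / y + S2 / N - 2 * z * u / y) \<le> 1 + 1 + cmod z"
      using 1 2 3 norm_triangle_ineq4[of "1 / y + S2 / N" "2 * z * u / y"]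
        norm_triangle_ineq[of "1 / y" "S2 / N"] by linarith
    thus ?thesis by (simp add: norm_divide N_def divide_right_mono)
  qed
  finally show "cmod ((normalized_log_deriv n z)\<^sup>2 - 1 / (z\<^sup>2 - 1)) \<le> (2 + cmod z) / n"
    by (simp add: u_def y_def)
qed

text \<open>
  Let \<open>v = 1 / sqrt_z2m1 z\<close>. The product \<open>(u - v) (u + v) = u\<^sup>2 - v\<^sup>2\<close> is small, and the
  second factor stays away from \<open>0\<close> because \<open>z u\<close> and \<open>z v\<close> both lie in the right half-plane, \<open>z u\<close>
  even to the right of \<open>1/2\<close>. This excludes convergence to the wrong root.
\<close>
lemma normalized_log_deriv_approx:
  assumes "n > 0" "cmod z \<ge> 2"
  shows "cmod (normalized_log_deriv n z - 1 / sqrt_z2m1 z) \<le> 2 * cmod z * ((2 + cmod z) / n)"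
proof -
  define u where "u = normalized_log_deriv n z"
  define v where "v = 1 / sqrt_z2m1 z"
  have s: "(sqrt_z2m1 z)\<^sup>2 = z\<^sup>2 - 1" "Re (z * v) > 0"
    using sqrt_z2m1_props[of z] assms(2) by (auto simp: v_def)
  have "1 / 2 \<le> Re (z * (u + v))"
    using normalized_log_deriv_bounds(3)[OF assms] s(2) by (simp add: u_def distrib_left)
  also have "\<dots> \<le> cmod z * cmod (u + v)" by (metis complex_Re_le_cmod norm_mult)
  finally have half: "1 \<le> 2 * cmod z * cmod (u + v)" by simp
  have "v\<^sup>2 = 1 / (z\<^sup>2 - 1)" by (simp add: v_def power_divide s(1))
  hence "(u + v) * (u - v) = u\<^sup>2 - 1 / (z\<^sup>2 - 1)"
    by (simp add: algebra_simps power2_eq_square)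
  hence "cmod (u + v) * cmod (u - v) \<le> (2 + cmod z) / n"
    using normalized_log_deriv_bounds(4)[OF assms] by (metis norm_mult u_def)
  hence "2 * cmod z * (cmod (u + v) * cmod (u - v)) \<le> 2 * cmod z * ((2 + cmod z) / n)"
    by (intro mult_left_mono) auto
  moreover have "1 * cmod (u - v) \<le> 2 * cmod z * cmod (u + v) * cmod (u - v)"
    using half by (intro mult_right_mono) auto
  ultimately show ?thesis by (simp add: u_def v_def mult_ac)
qed

section \<open>Polar Legendre polynomials in terms of Legendre polynomials\<close>

text \<open>
  By the Legendre equation \<open>(x\<^sup>2 - 1) L' / n\<close> is an antiderivative of \<open>(n + 1) L\<close>. Adjusting the constant
  so that the pole becomes a root gives the product of \<open>x - \<zeta>\<close> and the polar polynomial.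
\<close>
lemma polar_legendre_formula:
  assumes "n > 0"
  shows "of_nat n * ((z - \<zeta>) * poly (polar_legendre \<zeta> n) z) =
    (z\<^sup>2 - 1) * poly (pderiv (monic_legendre n)) z - (\<zeta>\<^sup>2 - 1) * poly (pderiv (monic_legendre n)) \<zeta>"
proof -
  define L where "L = monic_legendre n"
  define c where "c = (\<zeta>\<^sup>2 - 1) * poly (pderiv L) \<zeta>"
  define M where "M = [:-1, 0, 1:] * pderiv L - [:c:]"
  have "poly M \<zeta> = 0" by (simp add: M_def c_def power2_eq_square algebra_simps)
  then obtain Q where Q: "M = [:-\<zeta>, 1:] * Q" by (auto simp: poly_eq_0_iff_dvd)
  define P where "P = smult (1 / of_nat n) Q"
  have nP: "smult (of_nat n) ([:-\<zeta>, 1:] * P) = M" using assms by (simp add: P_def Q)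
  have "smult (of_nat n) (pderiv ([:-\<zeta>, 1:] * P)) = pderiv M"
    by (simp only: nP[symmetric] pderiv_smult)
  also have "\<dots> = legendre_op L" by (simp add: M_def legendre_op_def pderiv_diff pderiv_pCons)
  also have "\<dots> = smult (of_nat n) (smult (of_nat (n + 1)) L)"
    unfolding L_def monic_legendre_props(3)[of n] smult_smult of_nat_mult ..
  finally have P: "pderiv ([:-\<zeta>, 1:] * P) = smult (of_nat (n + 1)) L"
    using assms by (metis of_nat_eq_0_iff less_irrefl smult_cancel)
  have "polar_legendre \<zeta> n = P"
    unfolding polar_legendre_def L_def[symmetric]
  proof (rule the_equality)
    have L: "degree L = n" "lead_coeff L = 1"
      using monic_legendre_props[of n] by (simp_all add: L_def)
    have "P \<noteq> 0"
      using P L(2) by (metis mult_zero_right pderiv_0 smult_eq_0_iff of_nat_neq_0 Suc_eq_plus1 leading_coeff_0_iff zero_neq_one)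
    hence deg: "degree ([:-\<zeta>, 1:] * P) = Suc (degree P)"
      by (subst degree_mult_eq) auto
    have "degree P = degree (pderiv ([:-\<zeta>, 1:] * P))" unfolding degree_pderiv deg by simp
    also have "\<dots> = n" unfolding P degree_smult_eq using L by (simp del: of_nat_Suc of_nat_add)
    finally have dP: "degree P = n" .
    have "of_nat (n + 1) = coeff (pderiv ([:-\<zeta>, 1:] * P)) n" unfolding P using L by simp
    also have "\<dots> = of_nat (n + 1) * lead_coeff P"
      by (simp add: coeff_pderiv dP coeff_eq_0)
    finally have "lead_coeff P = 1" by (metis mult_cancel_left1 of_nat_neq_0 Suc_eq_plus1)
    thus "degree P = n \<and> lead_coeff P = 1 \<and> smult (of_nat (n + 1)) L = pderiv ([:-\<zeta>, 1:] * P)"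
      using dP P by simp
    fix P' assume P': "degree P' = n \<and> lead_coeff P' = 1 \<and>
      smult (of_nat (n + 1)) L = pderiv ([:-\<zeta>, 1:] * P')"
    have "pderiv ([:-\<zeta>, 1:] * (P' - P)) = 0"
      using P P' by (simp only: right_diff_distrib pderiv_diff) simp
    hence "degree ([:-\<zeta>, 1:] * (P' - P)) = 0" by (simp only: pderiv_eq_0_iff)
    hence "P' - P = 0" by (metis degree_mult_eq degree_pCons_eq_if add_is_0 nat.distinct(1)
        pCons_eq_0_iff zero_neq_one one_neq_zero)
    thus "P' = P" by simp
  qed
  hence "of_nat n * ((z - \<zeta>) * poly (polar_legendre \<zeta> n) z) = poly M z"
    by (simp add: nP[symmetric] left_diff_distrib)
  thus ?thesis by (simp add: M_def c_def L_def power2_eq_square algebra_simps)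
qed

text \<open>
  The bound is only asked for \<open>n > 0\<close>, as the derivative of the constant Legendre polynomial vanishes.
\<close>
lemma uniform_limit_of_norm_bound:
  fixes f :: "nat \<Rightarrow> 'a \<Rightarrow> 'b :: real_normed_vector"
  assumes "b \<longlonglongrightarrow> 0" "\<And>n x. n > 0 \<Longrightarrow> x \<in> K \<Longrightarrow> norm (f n x - g x) \<le> b n"
  shows "uniform_limit K f g sequentially"
proof (rule uniform_limitI)
  fix e :: real assume "e > 0"
  with assms(1) have "eventually (\<lambda>n. b n < e) sequentially" by (rule order_tendstoD)
  thus "\<forall>\<^sub>F n in sequentially. \<forall>x\<in>K. dist (f n x) (g x) < e"
    using eventually_gt_at_top[of 0]
  proof eventually_elim
    case (elim n)
    show ?case
    proof
      fix x assume "x \<in> K"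
      with assms(2)[OF elim(2) this] elim(1) show "dist (f n x) (g x) < e"
        unfolding dist_norm by linarith
    qed
  qed
qed

lemma normalized_log_deriv_uniform_limit:
  assumes "\<And>z. z \<in> K \<Longrightarrow> 2 \<le> cmod z" "\<And>z. z \<in> K \<Longrightarrow> cmod z \<le> R"
  shows "uniform_limit K normalized_log_deriv (\<lambda>z. 1 / sqrt_z2m1 z) sequentially"
proof (rule uniform_limit_of_norm_bound)
  show "(\<lambda>n. 2 * R * ((2 + R) / real n)) \<longlonglongrightarrow> 0"
    by (intro tendsto_eq_intros lim_const_over_n) auto
  fix n z assume "n > (0::nat)" "z \<in> K"
  thus "cmod (normalized_log_deriv n z - 1 / sqrt_z2m1 z) \<le> 2 * R * ((2 + R) / real n)"
    using assms(1,2)[of z]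
    by (intro order.trans[OF normalized_log_deriv_approx] mult_mono divide_right_mono) auto
qed

text \<open>
  All roots are within \<open>Delta \<zeta>\<close> of the pole, but at distance at least \<open>\<bar>z\<bar> - 1\<close> from \<open>z\<close>. So the value of
  \<open>L'\<close> at the pole is geometrically small compared with that at \<open>z\<close>. The lower bound
  \<open>\<bar>z L'(z)\<bar> \<ge> n \<bar>L(z)\<bar> / 2\<close> comes from the real part of the logarithmic derivative.
\<close>
lemma pderiv_legendre_pole_ratio:
  assumes "n > 0" "\<rho> > Delta \<zeta> + 1" "\<rho> \<le> cmod z"
  shows "poly (pderiv (monic_legendre n)) z \<noteq> 0"
    and "cmod (poly (pderiv (monic_legendre n)) \<zeta> / poly (pderiv (monic_legendre n)) z)
      \<le> 2 * cmod z * (Delta \<zeta> / (\<rho> - 1)) ^ n"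
proof -
  obtain x where x: "monic_legendre n = (\<Prod>i<n. [:- complex_of_real (x i), 1:])"
    "\<And>i. i < n \<Longrightarrow> x i \<in> {-1..1}"
    using monic_legendre_factorization[of n] by blast
  define L where "L = monic_legendre n"
  define D where "D = Delta \<zeta>"
  have z2: "cmod z \<ge> 2" and D: "D \<ge> 1" "\<rho> > D + 1"
    using assms(2,3) Delta_ge[of \<zeta>] by (auto simp: D_def)
  have num: "cmod (poly (pderiv L) \<zeta>) \<le> real n * D ^ n"
    unfolding L_def x(1) D_def using x(2) Delta_ge(1)[of \<zeta>]
    by (intro norm_poly_pderiv_prod_linear_le norm_diff_le_Delta) auto
  have "(\<rho> - 1) ^ n \<le> (cmod z - 1) ^ n" using assms(3) D by (intro power_mono) auto
  also have "\<dots> \<le> cmod (poly L z)"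
    unfolding L_def x(1) using x(2) z2 by (intro norm_poly_prod_linear_ge) (auto simp: abs_le_iff)
  finally have den0: "(\<rho> - 1) ^ n \<le> cmod (poly L z)" .
  have L': "poly (pderiv L) z = of_nat n * poly L z * normalized_log_deriv n z"
    using assms(1) normalized_log_deriv_bounds(1)[OF assms(1) z2] by (simp add: normalized_log_deriv_def L_def)
  have "1 / 2 \<le> cmod z * cmod (normalized_log_deriv n z)"
    using normalized_log_deriv_bounds(3)[OF assms(1) z2] complex_Re_le_cmod[of "z * normalized_log_deriv n z"]
    by (simp add: norm_mult)
  hence "n * (\<rho> - 1) ^ n * (1 / 2) \<le> n * cmod (poly L z) * (cmod z * cmod (normalized_log_deriv n z))"
    using den0 D by (intro mult_mono) auto
  hence den: "n * (\<rho> - 1) ^ n \<le> 2 * cmod z * cmod (poly (pderiv L) z)"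
    by (simp add: L' norm_mult mult_ac)
  have pos: "n * (\<rho> - 1) ^ n > 0" using assms(1) D by auto
  show ne: "poly (pderiv (monic_legendre n)) z \<noteq> 0" using den pos by (auto simp: L_def)
  have "cmod (poly (pderiv L) \<zeta>) * (n * (\<rho> - 1) ^ n) \<le>
      (n * D ^ n) * (2 * cmod z * cmod (poly (pderiv L) z))"
    using D pos by (intro mult_mono num den) auto
  hence "cmod (poly (pderiv L) \<zeta>) * (\<rho> - 1) ^ n \<le> D ^ n * (2 * cmod z * cmod (poly (pderiv L) z))"
    using assms(1) by (simp add: mult_ac)
  thus "cmod (poly (pderiv (monic_legendre n)) \<zeta> / poly (pderiv (monic_legendre n)) z)
      \<le> 2 * cmod z * (Delta \<zeta> / (\<rho> - 1)) ^ n"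
    using ne D unfolding L_def[symmetric] D_def[symmetric]
    by (simp add: norm_divide power_divide field_simps)
qed

section \<open>The two limits\<close>

text \<open>
  The error is exactly \<open>- (\<zeta>\<^sup>2 - 1) L'(\<zeta>) / ((z - \<zeta>) L'(z))\<close>.
\<close>
lemma polar_over_pderiv_uniform_limit:
  assumes "\<rho> > Delta \<zeta> + 1" "\<And>z. z \<in> K \<Longrightarrow> \<rho> \<le> cmod z" "\<And>z. z \<in> K \<Longrightarrow> cmod z \<le> R"
  shows "uniform_limit K
    (\<lambda>n z. of_nat n * poly (polar_legendre \<zeta> n) z / poly (pderiv (monic_legendre n)) z)
    (\<lambda>z. (z\<^sup>2 - 1) / (z - \<zeta>)) sequentially"
proof (rule uniform_limit_of_norm_bound)
  define q where "q = Delta \<zeta> / (\<rho> - 1)"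
  define C where "C = cmod (\<zeta>\<^sup>2 - 1)"
  have q: "0 \<le> q" "q < 1" using assms(1) Delta_ge[of \<zeta>] by (auto simp: q_def)
  show "(\<lambda>n. C * (2 * R * q ^ n)) \<longlonglongrightarrow> 0"
    using q by (intro tendsto_eq_intros LIMSEQ_realpow_zero) auto
  fix n z assume n: "n > (0::nat)" and z: "z \<in> K"
  have zz: "cmod (z - \<zeta>) \<ge> 1"
    using assms(1) assms(2)[OF z] Delta_ge(2)[of \<zeta>] norm_triangle_ineq2[of z \<zeta>] by linarith
  define a where "a = poly (pderiv (monic_legendre n)) z"
  define b where "b = poly (pderiv (monic_legendre n)) \<zeta>"
  have a: "a \<noteq> 0" and ba: "cmod (b / a) \<le> 2 * cmod z * q ^ n"
    using pderiv_legendre_pole_ratio[OF n assms(1) assms(2)[OF z]] by (auto simp: a_def b_def q_def)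
  have "of_nat n * poly (polar_legendre \<zeta> n) z / a - (z\<^sup>2 - 1) / (z - \<zeta>)
      = - ((\<zeta>\<^sup>2 - 1) * (b / a)) / (z - \<zeta>)"
  proof -
    have "z - \<zeta> \<noteq> 0" using zz by auto
    moreover have "of_nat n * poly (polar_legendre \<zeta> n) z * (z - \<zeta>) = (z\<^sup>2 - 1) * a - (\<zeta>\<^sup>2 - 1) * b"
      using polar_legendre_formula[OF n, of z \<zeta>] by (simp add: a_def b_def mult_ac)
    ultimately have "of_nat n * poly (polar_legendre \<zeta> n) z = ((z\<^sup>2 - 1) * a - (\<zeta>\<^sup>2 - 1) * b) / (z - \<zeta>)"
      by (simp add: nonzero_eq_divide_eq)
    thus ?thesis using a by (simp add: diff_divide_distrib)
  qed
  also have "cmod \<dots> = C * cmod (b / a) / cmod (z - \<zeta>)" by (simp add: norm_mult norm_divide C_def)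
  also have "\<dots> \<le> C * cmod (b / a) / 1"
    using zz by (intro divide_left_mono) (auto simp: C_def)
  also have "\<dots> \<le> C * (2 * R * q ^ n)"
    unfolding div_by_1 using assms(3)[OF z] q
    by (intro mult_left_mono order.trans[OF ba] mult_right_mono) (auto simp: C_def)
  finally show "cmod (of_nat n * poly (polar_legendre \<zeta> n) z / poly (pderiv (monic_legendre n)) z
      - (z\<^sup>2 - 1) / (z - \<zeta>)) \<le> C * (2 * R * q ^ n)" by (simp add: a_def)
qed

text \<open>
  The quotient \<open>P / L\<close> is the product of \<open>L' / (n L)\<close> and \<open>n P / L'\<close>, both of which converge
  uniformly to bounded functions.
\<close>
lemma polar_over_legendre_uniform_limit:
  assumes "\<rho> > Delta \<zeta> + 1" "\<And>z. z \<in> K \<Longrightarrow> \<rho> \<le> cmod z" "\<And>z. z \<in> K \<Longrightarrow> cmod z \<le> R"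
  shows "uniform_limit K
    (\<lambda>n z. poly (polar_legendre \<zeta> n) z / poly (monic_legendre n) z)
    (\<lambda>z. sqrt_z2m1 z / (z - \<zeta>)) sequentially"
proof -
  let ?G = "\<lambda>n z. of_nat n * poly (polar_legendre \<zeta> n) z / poly (pderiv (monic_legendre n)) z"
  have z2: "cmod z \<ge> 2" if "z \<in> K" for z
    using assms(1) assms(2)[OF that] Delta_ge(1)[of \<zeta>] by linarith
  have y: "cmod (z\<^sup>2 - 1) \<ge> 3" "cmod (z\<^sup>2 - 1) \<le> R\<^sup>2 + 1" if "z \<in> K" for z
  proof -
    have "cmod (z\<^sup>2) \<ge> 2\<^sup>2" "cmod (z\<^sup>2) \<le> R\<^sup>2"
      unfolding norm_power using z2[OF that] assms(3)[OF that] by (intro power_mono; simp)+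
    thus "cmod (z\<^sup>2 - 1) \<ge> 3" "cmod (z\<^sup>2 - 1) \<le> R\<^sup>2 + 1"
      using norm_triangle_ineq2[of "z\<^sup>2" 1] norm_triangle_ineq4[of "z\<^sup>2" 1] by simp_all
  qed
  have zz: "cmod (z - \<zeta>) \<ge> 1" if "z \<in> K" for z
    using assms(1) assms(2)[OF that] Delta_ge(2)[of \<zeta>] norm_triangle_ineq2[of z \<zeta>] by linarith
  have sq: "(sqrt_z2m1 z)\<^sup>2 = z\<^sup>2 - 1" if "z \<in> K" for z
    using sqrt_z2m1_props(1)[of z] z2[OF that] by simp
  have s1: "cmod (sqrt_z2m1 z) \<ge> 1" if "z \<in> K" for z
  proof (rule power2_le_imp_le)
    show "1\<^sup>2 \<le> (cmod (sqrt_z2m1 z))\<^sup>2"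
      unfolding norm_power[symmetric] sq[OF that] using y(1)[OF that] by simp
  qed simp
  have "uniform_limit K (\<lambda>n z. normalized_log_deriv n z * ?G n z)
      (\<lambda>z. 1 / sqrt_z2m1 z * ((z\<^sup>2 - 1) / (z - \<zeta>))) sequentially"
  proof (rule uniform_lim_mult)
    show "uniform_limit K normalized_log_deriv (\<lambda>z. 1 / sqrt_z2m1 z) sequentially"
      using z2 assms(3) by (rule normalized_log_deriv_uniform_limit)
    show "uniform_limit K ?G (\<lambda>z. (z\<^sup>2 - 1) / (z - \<zeta>)) sequentially"
      using assms by (rule polar_over_pderiv_uniform_limit)
    show "bounded ((\<lambda>z. 1 / sqrt_z2m1 z) ` K)"
      using s1 by (intro boundedI[of _ 1]) (auto simp: norm_divide divide_simps)
    show "bounded ((\<lambda>z. (z\<^sup>2 - 1) / (z - \<zeta>)) ` K)"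
    proof (rule boundedI)
      fix w assume "w \<in> (\<lambda>z. (z\<^sup>2 - 1) / (z - \<zeta>)) ` K"
      then obtain z where z: "z \<in> K" "w = (z\<^sup>2 - 1) / (z - \<zeta>)" by auto
      have "cmod w \<le> (R\<^sup>2 + 1) / 1"
        unfolding z(2) norm_divide using y(2)[OF z(1)] zz[OF z(1)] by (intro frac_le) auto
      thus "cmod w \<le> R\<^sup>2 + 1" by simp
    qed
  qed
  also have "?this \<longleftrightarrow> ?thesis"
  proof (rule uniform_limit_cong)
    show "\<forall>\<^sub>F n in sequentially. \<forall>z\<in>K. normalized_log_deriv n z * ?G n z =
        poly (polar_legendre \<zeta> n) z / poly (monic_legendre n) z"
      using eventually_gt_at_top[of 0]
    proof eventually_elim
      case (elim n)
      show ?case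
      proof
        fix z assume "z \<in> K"
        thus "normalized_log_deriv n z * ?G n z = poly (polar_legendre \<zeta> n) z / poly (monic_legendre n) z"
          using elim pderiv_legendre_pole_ratio(1)[OF elim assms(1) assms(2)]
          by (simp add: normalized_log_deriv_def)
      qed
    qed
    fix z assume "z \<in> K"
    hence "sqrt_z2m1 z \<noteq> 0" using s1[of z] by auto
    thus "1 / sqrt_z2m1 z * ((z\<^sup>2 - 1) / (z - \<zeta>)) = sqrt_z2m1 z / (z - \<zeta>)"
      unfolding sq[OF \<open>z \<in> K\<close>, symmetric] by (simp add: power2_eq_square)
  qed
  finally show ?thesis .
qed

lemma compact_norm_bounds:
  assumes "compact K" "K \<subseteq> {z :: complex. cmod z > a}"
  obtains \<rho> R where "\<rho> > a" "\<And>z. z \<in> K \<Longrightarrow> \<rho> \<le> cmod z" "\<And>z. z \<in> K \<Longrightarrow> cmod z \<le> R"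
proof (cases "K = {}")
  case True
  thus ?thesis using that[of "a + 1"] by auto
next
  case False
  obtain w where w: "w \<in> K" "\<And>z. z \<in> K \<Longrightarrow> cmod w \<le> cmod z"
    using continuous_attains_inf[OF assms(1) False, of cmod] by (auto intro: continuous_intros)
  obtain R where "\<And>z. z \<in> K \<Longrightarrow> cmod z \<le> R"
    using compact_imp_bounded[OF assms(1)] by (auto simp: bounded_iff)
  thus ?thesis using that[of "cmod w" R] w assms(2) by auto
qed

theorem theorem4:
  fixes \<zeta> :: complex
  shows
    "(\<forall>K. compact K \<and> K \<subseteq> {z :: complex. cmod z > Delta \<zeta> + 1} \<longrightarrow>
        uniform_limit K
          (\<lambda>n z. of_nat n * poly (polar_legendre \<zeta> n) z / poly (pderiv (monic_legendre n)) z)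
          (\<lambda>z. (z\<^sup>2 - 1) / (z - \<zeta>)) sequentially) \<and>
     (\<forall>K. compact K \<and> K \<subseteq> {z :: complex. cmod z > Delta \<zeta> + 1} \<longrightarrow>
        uniform_limit K
          (\<lambda>n z. poly (polar_legendre \<zeta> n) z / poly (monic_legendre n) z)
          (\<lambda>z. sqrt_z2m1 z / (z - \<zeta>)) sequentially)"
proof (intro conjI allI impI; elim conjE)
  fix K assume "compact K" "K \<subseteq> {z. cmod z > Delta \<zeta> + 1}"
  then obtain \<rho> R where *: "\<rho> > Delta \<zeta> + 1" "\<And>z. z \<in> K \<Longrightarrow> \<rho> \<le> cmod z" "\<And>z. z \<in> K \<Longrightarrow> cmod z \<le> R"
    using compact_norm_bounds by metis
  show "uniform_limit K
          (\<lambda>n z. of_nat n * poly (polar_legendre \<zeta> n) z / poly (pderiv (monic_legendre n)) z)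
          (\<lambda>z. (z\<^sup>2 - 1) / (z - \<zeta>)) sequentially"
    using * by (rule polar_over_pderiv_uniform_limit)
  show "uniform_limit K
          (\<lambda>n z. poly (polar_legendre \<zeta> n) z / poly (monic_legendre n) z)
          (\<lambda>z. sqrt_z2m1 z / (z - \<zeta>)) sequentially"
    using * by (rule polar_over_legendre_uniform_limit)
qed

end
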